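(* For every $\varepsilon>0$, as $X\to\infty$, \[ \Gamma(X)=\sum_{1\leq n\leq X}\mu^2(n^2+n+1)=\sigma X+\mathcal{O}_\varepsilon\!\left(X^{\frac{4}{5}+\varepsilon}\right), \] where \[ \sigma=\prod_{p}\left(1-\frac{\lambda(p^2)}{p^2}\right), \] the product being over all primes $p$. In particular, there are infinitely many positive integers $n$ such that $n^2+n+1$ is square-free.
   Context: $X$ is a large positive real number, $n$ runs over positive integers, and $\mu$ is the Möbius function, so $\mu^2(m)=1$ if $m$ is square-free and $0$ otherwise. For a positive integer $q$, $\lambda(q)$ denotes the number of integers $n$ with $1\leq n\leq q$ and $n^2+n+1\equiv 0 \pmod q$. The implied constant in $\mathcal{O}$ depends only on $\varepsilon$. *)

theory Defs
  imports
    "HOL-Analysis.Analysis"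
    "HOL-Library.Landau_Symbols"
    "HOL-Number_Theory.Cong"
    "HOL-Computational_Algebra.Squarefree"
begin

definition moebius_mu :: "nat \<Rightarrow> int" where
  "moebius_mu m = (if squarefree m then (-1) ^ card (prime_factors m) else 0)"

definition lam :: "nat \<Rightarrow> nat" where
  "lam q = card {n \<in> {1..q}. [n\<^sup>2 + n + 1 = 0] (mod q)}"

definition Gamma_sum :: "real \<Rightarrow> real" where
  "Gamma_sum X = (\<Sum>n | 1 \<le> n \<and> real n \<le> X. of_int ((moebius_mu (n\<^sup>2 + n + 1))\<^sup>2))"

(* The product over primes is a product over all naturals, with factor 1 at non-primes. *)
definition euler_factor :: "nat \<Rightarrow> real" where
  "euler_factor p = (if prime p then 1 - real (lam (p\<^sup>2)) / real (p\<^sup>2) else 1)"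

definition sigma_const :: real where
  "sigma_const = prodinf euler_factor"

end

theory Submission
  imports Defs "HOL-Real_Asymp.Real_Asymp"
begin

text \<open>
  Estermann's argument. Write the indicator of square-free \<open>m\<close> as the sum of \<open>\<mu>(d)\<close> over
  \<open>d\<^sup>2 dvd m\<close> and cut at \<open>y = N powr (3 / 5)\<close>. For \<open>d \<le> y\<close> the number of \<open>n \<le> N\<close> with
  \<open>d\<^sup>2 dvd n\<^sup>2 + n + 1\<close> is \<open>N * lam (d\<^sup>2) / d\<^sup>2\<close> up to \<open>lam (d\<^sup>2)\<close>, and \<open>lam (d\<^sup>2)\<close> is at most a
  constant times \<open>d powr (1 / 3)\<close>. For \<open>d > y\<close> put \<open>n\<^sup>2 + n + 1 = k * d\<^sup>2\<close>, so that
  \<open>k \<le> 3 * N\<^sup>2 / y\<^sup>2\<close>. For fixed \<open>k\<close> the pair \<open>(x, z) = (2 * n + 1, 2 * d)\<close> solves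
  \<open>x\<^sup>2 - k * z\<^sup>2 = -3\<close>; two solutions that are congruent modulo 3 differ by a unit of norm 1 in
  \<open>\<int>[sqrt k]\<close>, so their sizes differ by a factor of at least 2 and there are only
  \<open>O(log N)\<close> solutions. All error terms are then \<open>O(N powr (4 / 5) * log N)\<close>.
\<close>

section \<open>Roots of \<open>n\<^sup>2 + n + 1\<close> modulo \<open>q\<close>\<close>

definition quad :: "nat \<Rightarrow> nat" where
  "quad n = n\<^sup>2 + n + 1"

lemma dvd_quad_cong:
  assumes "[m = n] (mod q)"
  shows "q dvd quad m \<longleftrightarrow> q dvd quad n"
  unfolding quad_def by (rule cong_dvd_iff) (intro cong_add cong_pow cong_refl assms)

lemma dvd_quad_mod_iff [simp]: "q dvd quad (n mod q) \<longleftrightarrow> q dvd quad n"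
  by (rule dvd_quad_cong) (simp add: cong_def)

lemma int_quad: "int (quad n) = (int n)\<^sup>2 + int n + 1"
  by (simp add: quad_def)

text \<open>Reduction modulo \<open>q\<close> maps any \<open>q\<close> consecutive integers
  bijectively onto the residues below \<open>q\<close>, so the count does not depend on
  \<open>a\<close>. The case \<open>a = 0\<close> is the definition of \<open>lam\<close>.\<close>

lemma card_quad_block:
  assumes "q > 0"
  shows "card {n \<in> {a<..a + q}. q dvd quad n} = lam q"
proof -
  define S where "S = {r. r < q \<and> q dvd quad r}"
  have block: "card {n \<in> {a<..a + q}. q dvd quad n} = card S" for a
  proof -
    have inj: "inj_on (\<lambda>n. n mod q) {a<..a + q}"
    proof (rule inj_onI)
      fix x y assume *: "x \<in> {a<..a + q}" "y \<in> {a<..a + q}" "x mod q = y mod q"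
      have "x = y" if "x \<le> y" "y \<in> {a<..a + q}" "x \<in> {a<..a + q}" "x mod q = y mod q" for x y
      proof -
        have "q dvd y - x" using that by (metis mod_eq_dvd_iff_nat)
        moreover have "y - x < q" using that by auto
        ultimately have "y - x = 0" by (metis dvd_imp_le not_less gr_zeroI)
        with that show ?thesis by simp
      qed
      with * show "x = y" by (metis nat_le_linear)
    qed
    have img: "(\<lambda>n. n mod q) ` {a<..a + q} = {..<q}"
    proof (rule card_subset_eq)
      show "(\<lambda>n. n mod q) ` {a<..a + q} \<subseteq> {..<q}" using assms by auto
      show "card ((\<lambda>n. n mod q) ` {a<..a + q}) = card {..<q}"
        by (subst card_image[OF inj]) simp
    qed simp
    have "(\<lambda>n. n mod q) ` {n \<in> {a<..a + q}. q dvd quad n} = S"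
    proof
      show "(\<lambda>n. n mod q) ` {n \<in> {a<..a + q}. q dvd quad n} \<subseteq> S"
        using assms by (auto simp: S_def)
      show "S \<subseteq> (\<lambda>n. n mod q) ` {n \<in> {a<..a + q}. q dvd quad n}"
      proof
        fix r assume r: "r \<in> S"
        hence "r \<in> (\<lambda>n. n mod q) ` {a<..a + q}" unfolding img by (simp add: S_def)
        then obtain n where n: "n \<in> {a<..a + q}" "r = n mod q" by blast
        moreover have "q dvd quad n"
          using r n dvd_quad_cong[of r n q] by (simp add: S_def)
        ultimately show "r \<in> (\<lambda>n. n mod q) ` {n \<in> {a<..a + q}. q dvd quad n}" by blast
      qed
    qed
    moreover have "inj_on (\<lambda>n. n mod q) {n \<in> {a<..a + q}. q dvd quad n}"
      by (rule inj_on_subset[OF inj]) auto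
    ultimately show ?thesis by (metis card_image)
  qed
  have "{n \<in> {1..q}. [n\<^sup>2 + n + 1 = 0] (mod q)} = {n \<in> {0<..0 + q}. q dvd quad n}"
    by (auto simp: cong_0_iff quad_def)
  hence "lam q = card S" unfolding lam_def using block[of 0] by simp
  thus ?thesis using block[of a] by simp
qed

lemma card_quad_interval_le:
  assumes "q > 0" "r \<le> q"
  shows "card {n \<in> {a<..a + r}. q dvd quad n} \<le> lam q"
  unfolding card_quad_block[OF assms(1), of a, symmetric]
  by (rule card_mono) (use assms in auto)

text \<open>The ranges \<open>{1..q}\<close> and \<open>{0..<q}\<close> differ only in representing
  the zero class by \<open>q\<close> or by \<open>0\<close>. As \<open>quad 0 = 1\<close>, that
  class is a root only for \<open>q = 1\<close>, which is treated separately.\<close>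

lemma lam_eq_card_residues:
  assumes "q > 0"
  shows "lam q = card {n. n < q \<and> q dvd quad n}"
proof (cases "q = 1")
  case True
  have "{n. n < 1 \<and> 1 dvd quad n} = {0::nat}" by auto
  moreover have "lam 1 = 1" by (simp add: lam_def)
  ultimately show ?thesis using True by simp
next
  case False
  hence "\<not> q dvd quad 0" by (simp add: quad_def)
  hence "\<not> q dvd quad q" using dvd_quad_cong[of q 0 q] by (simp add: cong_def)
  with False have "{n. n < q \<and> q dvd quad n} = {n \<in> {0<..0 + q}. q dvd quad n}"
    using \<open>\<not> q dvd quad 0\<close> by (auto simp: order_le_less intro!: gr0I)
  with card_quad_block[OF assms, of 0] show ?thesis by simp
qed

text \<open>By the Chinese remainder theorem, a root modulo \<open>a * b\<close> is the same as a
  pair of roots modulo \<open>a\<close> and modulo \<open>b\<close>.\<close>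

lemma lam_mult_coprime:
  assumes "coprime a b" "a > 0" "b > 0"
  shows "lam (a * b) = lam a * lam b"
proof -
  define S where "S = (\<lambda>q. {n. n < q \<and> q dvd quad n})"
  have "bij_betw (\<lambda>x. (x mod a, x mod b)) (S (a * b)) (S a \<times> S b)"
    unfolding bij_betw_def
  proof
    show "inj_on (\<lambda>x. (x mod a, x mod b)) (S (a * b))"
    proof (rule inj_onI)
      fix x y assume xy: "x \<in> S (a * b)" "y \<in> S (a * b)"
        "(x mod a, x mod b) = (y mod a, y mod b)"
      hence "[x = y] (mod a * b)"
        by (intro coprime_cong_mult_nat) (auto simp: cong_def assms)
      with xy show "x = y" by (auto simp: S_def cong_def)
    qed
    show "(\<lambda>x. (x mod a, x mod b)) ` S (a * b) = S a \<times> S b"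
    proof
      show "(\<lambda>x. (x mod a, x mod b)) ` S (a * b) \<subseteq> S a \<times> S b"
        using assms
        by (auto simp: S_def dest: dvd_mult_left dvd_mult_right)
      show "S a \<times> S b \<subseteq> (\<lambda>x. (x mod a, x mod b)) ` S (a * b)"
      proof clarify
        fix u v assume u: "u \<in> S a" and v: "v \<in> S b"
        obtain x where x: "x < a * b" "[x = u] (mod a)" "[x = v] (mod b)"
          using binary_chinese_remainder_unique_nat[OF assms(1)] assms by blast
        have "a dvd quad x" "b dvd quad x"
          using dvd_quad_cong[OF x(2)] dvd_quad_cong[OF x(3)] u v by (auto simp: S_def)
        hence "a * b dvd quad x" using assms(1) by (rule divides_mult)
        with x have "x \<in> S (a * b)" by (simp add: S_def)
        moreover have "x mod a = u" "x mod b = v" using x u v by (auto simp: cong_def S_def)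
        ultimately show "(u, v) \<in> (\<lambda>x. (x mod a, x mod b)) ` S (a * b)" by force
      qed
    qed
  qed
  hence "card (S (a * b)) = card (S a) * card (S b)"
    by (simp add: bij_betw_same_card card_cartesian_product)
  thus ?thesis using assms by (simp add: lam_eq_card_residues S_def)
qed

text \<open>The prime 3 divides the discriminant -3 of the polynomial; its only root modulo 3, the
  double root 1, does not lift modulo 9. This settles the exceptional prime in the next
  lemma.\<close>

lemma lam_nine: "lam 9 = 0"
proof -
  have "\<not> 9 dvd quad n" if "n < 9" for n :: nat
  proof -
    have "n \<in> {0,1,2,3,4,5,6,7,8}" using that by auto
    thus ?thesis by (elim insertE emptyE) (simp_all add: quad_def dvd_eq_mod_eq_0 del: One_nat_def)
  qed
  thus ?thesis by (simp add: lam_eq_card_residues)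
qed

text \<open>The difference of two values of the polynomial factors as
  \<open>(m - a) * (m + a + 1)\<close>. For \<open>p \<noteq> 3\<close> at most one factor is
  divisible by \<open>p\<close>, so \<open>p\<^sup>2\<close> divides one of them entirely, and
  \<open>m\<close> is congruent to \<open>a\<close> or to \<open>-1 - a\<close>.\<close>

lemma lam_prime_square_le:
  assumes "prime p"
  shows "lam (p\<^sup>2) \<le> 2"
proof (cases "p = 3")
  case True thus ?thesis by (simp add: lam_nine)
next
  case False
  define S where "S = {n. n < p\<^sup>2 \<and> p\<^sup>2 dvd quad n}"
  have p: "p > 1" using assms prime_gt_1_nat by blast
  show ?thesis
  proof (cases "S = {}")
    case True
    have "lam (p\<^sup>2) = card S" unfolding S_def by (rule lam_eq_card_residues) (use p in simp)
    with True show ?thesis by simp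
  next
    case False
    then obtain a where a: "a \<in> S" by blast
    \<comment> \<open>The two roots add up to -1, and \<open>p\<^sup>2 - 1 - a\<close> represents
      \<open>-1 - a\<close>; the subtraction is not truncated because
      \<open>a < p\<^sup>2\<close>.\<close>
    have "S \<subseteq> {a, p\<^sup>2 - 1 - a}"
    proof
      fix m assume m: "m \<in> S"
      have "int (p\<^sup>2) dvd int (quad a)" "int (p\<^sup>2) dvd int (quad m)"
        using a m by (simp_all only: of_nat_dvd_iff S_def mem_Collect_eq)
      hence ds: "(int p)\<^sup>2 dvd (int a)\<^sup>2 + int a + 1" "(int p)\<^sup>2 dvd (int m)\<^sup>2 + int m + 1"
        by (simp_all only: int_quad of_nat_power)
      hence "(int p)\<^sup>2 dvd ((int m)\<^sup>2 + int m + 1) - ((int a)\<^sup>2 + int a + 1)" by (rule dvd_diff[rotated])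
      also have "\<dots> = (int m - int a) * (int m + int a + 1)" by (simp add: power2_eq_square algebra_simps)
      finally have d: "(int p)\<^sup>2 dvd (int m - int a) * (int m + int a + 1)" .
      have pi: "prime (int p)" using assms by simp
      have "\<not> (int p dvd int m - int a \<and> int p dvd int m + int a + 1)"
      proof
        assume *: "int p dvd int m - int a \<and> int p dvd int m + int a + 1"
        \<comment> \<open>This difference is \<open>2 * a + 1\<close>, and
          \<open>4 * (a\<^sup>2 + a + 1) - (2 * a + 1)\<^sup>2 = 3\<close> then forces
          \<open>p = 3\<close>.\<close>
        hence "int p dvd (int m + int a + 1) - (int m - int a)" by (blast intro: dvd_diff)
        hence "int p dvd (2 * int a + 1) * (2 * int a + 1)" by (intro dvd_mult) (simp add: algebra_simps)
        moreover have "int p dvd 4 * ((int a)\<^sup>2 + int a + 1)"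
          using ds(1) by (intro dvd_mult) (metis dvd_mult_left power2_eq_square)
        ultimately have "int p dvd 4 * ((int a)\<^sup>2 + int a + 1) - (2 * int a + 1) * (2 * int a + 1)"
          by (rule dvd_diff[rotated])
        also have "\<dots> = 3" by (simp add: power2_eq_square algebra_simps)
        finally have "p dvd 3" by (metis of_nat_dvd_iff of_nat_numeral)
        moreover have "prime (3::nat)" by simp
        ultimately show False using \<open>p \<noteq> 3\<close> assms by (metis primes_dvd_imp_eq)
      qed
      then consider "coprime (int p) (int m - int a)" | "coprime (int p) (int m + int a + 1)"
        using pi prime_imp_coprime by blast
      hence "(int p)\<^sup>2 dvd int m - int a \<or> (int p)\<^sup>2 dvd int m + int a + 1"
      proof cases
        case 1 thus ?thesis using d by (metis coprime_dvd_mult_right_iff coprime_power_left_iff)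
      next
        case 2 thus ?thesis using d by (metis coprime_dvd_mult_left_iff coprime_power_left_iff)
      qed
      thus "m \<in> {a, p\<^sup>2 - 1 - a}"
      proof
        assume "(int p)\<^sup>2 dvd int m - int a"
        hence "[int m = int a] (mod int (p\<^sup>2))" by (simp add: cong_iff_dvd_diff)
        hence "[m = a] (mod p\<^sup>2)" by (simp only: cong_int_iff)
        thus ?thesis using a m by (simp add: cong_def S_def)
      next
        assume "(int p)\<^sup>2 dvd int m + int a + 1"
        hence "p\<^sup>2 dvd m + a + 1"
          by (metis of_nat_1 of_nat_add of_nat_dvd_iff of_nat_power)
        then obtain c where c: "m + a + 1 = p\<^sup>2 * c" by blast
        have "m + a + 1 < p\<^sup>2 * 2" using a m by (auto simp: S_def)
        hence "c < 2" using c by (metis mult_less_cancel1)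
        moreover have "c \<noteq> 0" using c by (metis add_is_0 mult_0_right one_neq_zero)
        ultimately have "c = 1" by simp
        thus ?thesis using c by auto
      qed
    qed
    hence "card S \<le> card {a, p\<^sup>2 - 1 - a}" by (rule card_mono[rotated]) simp
    also have "\<dots> \<le> 2" by (simp add: card_insert_if)
    finally show ?thesis using p by (simp add: lam_eq_card_residues S_def)
  qed
qed

section \<open>Counting roots in initial segments\<close>

lemma card_quad_blocks:
  assumes "q > 0"
  shows "card {n \<in> {1..q * a}. q dvd quad n} = a * lam q"
proof (induction a)
  case (Suc a)
  have eq: "{n \<in> {1..q * Suc a}. q dvd quad n} =
      {n \<in> {1..q * a}. q dvd quad n} \<union> {n \<in> {q * a<..q * a + q}. q dvd quad n}"
    by auto
  have "card {n \<in> {1..q * Suc a}. q dvd quad n} =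
      card {n \<in> {1..q * a}. q dvd quad n} + card {n \<in> {q * a<..q * a + q}. q dvd quad n}"
    unfolding eq by (rule card_Un_disjoint) auto
  thus ?case unfolding Suc card_quad_block[OF assms] by simp
qed simp

text \<open>Complete blocks of length \<open>q\<close> contribute exactly \<open>lam q\<close> each.
  The incomplete last block and its expected share \<open>r / q * lam q\<close> both lie between 0
  and \<open>lam q\<close>.\<close>

lemma card_quad_approx:
  assumes "q > 0"
  shows "\<bar>real (card {n \<in> {1..N}. q dvd quad n}) - real N * real (lam q) / real q\<bar> \<le> lam q"
proof -
  define a r where "a = N div q" and "r = N mod q"
  have N: "N = q * a + r" "r < q" using assms by (simp_all add: a_def r_def)
  have eq: "{n \<in> {1..N}. q dvd quad n} =
      {n \<in> {1..q * a}. q dvd quad n} \<union> {n \<in> {q*a<..q*a+r}. q dvd quad n}"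
    using N by auto
  have c: "card {n \<in> {1..N}. q dvd quad n} =
      a * lam q + card {n \<in> {q*a<..q*a+r}. q dvd quad n}"
    unfolding eq card_quad_blocks[OF assms, symmetric] by (rule card_Un_disjoint) auto
  have le: "card {n \<in> {q*a<..q*a+r}. q dvd quad n} \<le> lam q"
    by (rule card_quad_interval_le) (use N assms in auto)
  have "real (card {n \<in> {1..N}. q dvd quad n}) \<ge> a * lam q"
    "real (card {n \<in> {1..N}. q dvd quad n}) \<le> a * lam q + lam q"
    unfolding c using le by (simp_all only: of_nat_le_iff)
  moreover have "real N * real (lam q) / real q = a * lam q + real r / real q * lam q"
    using assms N(1) by (simp add: field_simps)
  moreover have "0 \<le> real r / real q * lam q" by simp
  moreover have "real r / real q * lam q \<le> 1 * real (lam q)"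
    using N assms by (intro mult_right_mono) auto
  ultimately show ?thesis unfolding abs_le_iff of_nat_add of_nat_mult by linarith
qed

section \<open>Square-free divisors\<close>

lemma prime_factors_prod_primes:
  assumes "finite S" "\<And>p. p \<in> S \<Longrightarrow> prime (p :: nat)"
  shows "prime_factors (\<Prod>S) = S"
proof -
  have "prime_factors (prod id S) = (\<Union>p\<in>S. prime_factors p)"
    using assms(1) assms(2)[of 0] by (subst prime_factors_prod) auto
  also have "\<dots> = S" using assms by (auto simp: prime_prime_factors)
  finally show ?thesis by simp
qed

lemma squarefree_prod_primes:
  assumes "\<And>p. p \<in> S \<Longrightarrow> prime (p :: nat)"
  shows "squarefree (\<Prod>S)"
  by (rule squarefree_prod_coprime) (use assms in \<open>auto intro: primes_coprime squarefree_prime\<close>)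

lemma prod_prime_factors_squarefree:
  assumes "squarefree (d :: nat)"
  shows "\<Prod>(prime_factors d) = d"
proof -
  have d: "d \<noteq> 0" using assms by (metis not_squarefree_0)
  have "d = (\<Prod>p\<in>prime_factors d. p ^ multiplicity p d)"
    using d by (simp add: prod_prime_factors)
  also have "\<dots> = (\<Prod>p\<in>prime_factors d. p)"
    using assms d by (intro prod.cong) (auto simp: squarefree_factorial_semiring')
  finally show ?thesis by simp
qed

text \<open>Multiplying out gives a sum over subsets of \<open>P\<close>; a subset corresponds to
  the square-free product of its elements, and its sign is the Moebius function. It is applied with
  \<open>g = 1\<close> to detect square-free numbers and with the local root densities to expand the
  Euler product.\<close>

lemma prod_one_minus_primes:
  fixes g :: "nat \<Rightarrow> real"
  assumes P: "finite P" "\<And>p. p \<in> P \<Longrightarrow> prime p"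
  shows "(\<Prod>p\<in>P. 1 - g p) =
    (\<Sum>d | squarefree d \<and> prime_factors d \<subseteq> P. real_of_int (moebius_mu d) * (\<Prod>p\<in>prime_factors d. g p))"
proof -
  have "(\<Prod>p\<in>P. 1 - g p) = (\<Sum>S\<in>Pow P. (-1) ^ card S * (\<Prod>p\<in>S. g p))"
    by (subst prod_diff_conv_sum[OF P(1)]) simp
  also have "\<dots> = (\<Sum>d | squarefree d \<and> prime_factors d \<subseteq> P.
      real_of_int (moebius_mu d) * (\<Prod>p\<in>prime_factors d. g p))"
  proof (rule sum.reindex_bij_witness[of _ prime_factors Prod])
    fix S assume "S \<in> Pow P"
    hence S: "finite S" "\<And>p. p \<in> S \<Longrightarrow> prime p" "S \<subseteq> P"
      using P finite_subset by auto
    show "prime_factors (\<Prod>S) = S" using S by (intro prime_factors_prod_primes)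
    thus "\<Prod>S \<in> {d. squarefree d \<and> prime_factors d \<subseteq> P}"
      "real_of_int (moebius_mu (\<Prod>S)) * (\<Prod>p\<in>prime_factors (\<Prod>S). g p) = (-1) ^ card S * (\<Prod>p\<in>S. g p)"
      using S squarefree_prod_primes[of S] by (simp_all add: moebius_mu_def)
  qed (auto simp: prod_prime_factors_squarefree)
  finally show ?thesis .
qed

lemma finite_squarefree_supported:
  assumes "finite P" "\<And>p. p \<in> P \<Longrightarrow> prime (p :: nat)"
  shows "finite {d. squarefree d \<and> prime_factors d \<subseteq> P}"
proof (rule finite_subset)
  show "{d. squarefree d \<and> prime_factors d \<subseteq> P} \<subseteq> Prod ` Pow P"
  proof
    fix d assume "d \<in> {d. squarefree d \<and> prime_factors d \<subseteq> P}"
    thus "d \<in> Prod ` Pow P"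
      by (intro image_eqI[of _ _ "prime_factors d"]) (auto simp: prod_prime_factors_squarefree)
  qed
qed (use assms in auto)

text \<open>Squares of distinct primes are coprime, so if each of them divides \<open>m\<close>, so
  does their product.\<close>

lemma squarefree_square_dvd_iff:
  assumes "squarefree (d :: nat)"
  shows "d\<^sup>2 dvd m \<longleftrightarrow> (\<forall>p\<in>prime_factors d. p\<^sup>2 dvd m)"
proof
  assume "d\<^sup>2 dvd m"
  thus "\<forall>p\<in>prime_factors d. p\<^sup>2 dvd m"
    by (auto simp: in_prime_factors_iff intro: dvd_trans dvd_power_same)
next
  assume *: "\<forall>p\<in>prime_factors d. p\<^sup>2 dvd m"
  have "(\<Prod>p\<in>S. p\<^sup>2) dvd m" if "finite S" "S \<subseteq> prime_factors d" for S
    using that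
  proof (induction S rule: finite_induct)
    case (insert p S)
    have "coprime (p\<^sup>2) (\<Prod>q\<in>S. q\<^sup>2)"
    proof (rule prod_coprime_right)
      fix q assume "q \<in> S"
      hence "prime p" "prime q" "p \<noteq> q" using insert by auto
      thus "coprime (p\<^sup>2) (q\<^sup>2)" using primes_coprime by simp
    qed
    moreover have "p\<^sup>2 dvd m" "(\<Prod>q\<in>S. q\<^sup>2) dvd m" using * insert by auto
    ultimately show ?case using insert by (simp add: divides_mult)
  qed simp
  from this[of "prime_factors d"] have "(\<Prod>p\<in>prime_factors d. p\<^sup>2) dvd m" by simp
  thus "d\<^sup>2 dvd m"
    by (simp only: prod_prime_factors_squarefree[OF assms] flip: prod_power_distrib)
qed

text \<open>With \<open>P\<close> the primes whose square divides \<open>m\<close>, the sum is the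
  expansion of \<open>(1 - 1) ^ card P\<close>, which is 1 exactly when \<open>P\<close> is
  empty.\<close>

lemma sum_moebius_square_dvd:
  assumes "m > 0"
  shows "(\<Sum>d | squarefree d \<and> d\<^sup>2 dvd m. real_of_int (moebius_mu d)) = (if squarefree m then 1 else 0)"
proof -
  define P where "P = {p. prime p \<and> p\<^sup>2 dvd m}"
  have fin: "finite P"
  proof (rule finite_subset)
    show "P \<subseteq> {p. p dvd m}" unfolding P_def by (auto intro: dvd_trans[rotated])
  qed (use assms in simp)
  have "(\<Prod>p\<in>P. 1 - 1) = (\<Sum>d | squarefree d \<and> prime_factors d \<subseteq> P. real_of_int (moebius_mu d) * (\<Prod>p\<in>prime_factors d. 1))"
    by (rule prod_one_minus_primes) (use fin in \<open>auto simp: P_def\<close>)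
  moreover have "{d. squarefree d \<and> prime_factors d \<subseteq> P} = {d. squarefree d \<and> d\<^sup>2 dvd m}"
    by (auto simp: squarefree_square_dvd_iff P_def)
  moreover have "squarefree m \<longleftrightarrow> P = {}"
    using assms squarefree_factorial_semiring[of m] by (auto simp: P_def)
  ultimately show ?thesis using fin by (auto simp: power_0_left)
qed

lemma moebius_mu_square: "(moebius_mu m)\<^sup>2 = (if squarefree m then 1 else 0)"
  by (simp add: moebius_mu_def flip: power_mult)

lemma abs_moebius_mu_le: "\<bar>real_of_int (moebius_mu m)\<bar> \<le> 1"
  by (simp add: moebius_mu_def power_abs)

section \<open>Growth of \<open>lam (d\<^sup>2)\<close> for square-free \<open>d\<close>\<close>

lemma lam_one: "lam 1 = 1"
  by (simp add: lam_def)

lemma lam_square_squarefree: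
  assumes "squarefree d"
  shows "lam (d\<^sup>2) = (\<Prod>p\<in>prime_factors d. lam (p\<^sup>2))"
proof -
  have "lam ((\<Prod>S)\<^sup>2) = (\<Prod>p\<in>S. lam (p\<^sup>2))" if "finite S" "\<forall>p\<in>S. prime p" for S
    using that
  proof (induction S rule: finite_induct)
    case (insert p S)
    have "coprime p (\<Prod>S)"
      by (rule prod_coprime_right) (use insert in \<open>auto intro: primes_coprime\<close>)
    hence "lam (p\<^sup>2 * (\<Prod>S)\<^sup>2) = lam (p\<^sup>2) * lam ((\<Prod>S)\<^sup>2)"
      using insert by (intro lam_mult_coprime) (auto simp: prime_gt_0_nat intro!: prod_pos)
    thus ?case using insert by (simp add: power_mult_distrib)
  qed (simp add: lam_one[simplified])
  moreover have "\<forall>p\<in>prime_factors d. prime p" by auto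
  ultimately have "lam ((\<Prod>(prime_factors d))\<^sup>2) = (\<Prod>p\<in>prime_factors d. lam (p\<^sup>2))" by blast
  thus ?thesis unfolding prod_prime_factors_squarefree[OF assms] .
qed

lemma two_le_powr_third:
  assumes "x \<ge> (8::real)"
  shows "2 \<le> x powr (1 / 3)"
proof -
  have "(2::real) = (2 powr 3) powr (1 / 3)" by (subst powr_powr) simp
  also have "\<dots> = 8 powr (1 / 3)" by simp
  also have "\<dots> \<le> x powr (1 / 3)" using assms by (intro powr_mono2) auto
  finally show ?thesis .
qed

text \<open>Each prime factor contributes at most 2, which is at most \<open>p powr (1 / 3)\<close>
  once \<open>p \<ge> 8\<close>. Smaller primes need an extra factor 2 each.\<close>

lemma lam_square_le:
  assumes "squarefree d"
  shows "real (lam (d\<^sup>2)) \<le> 256 * real d powr (1 / 3)"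
proof -
  have "real (lam (d\<^sup>2)) = (\<Prod>p\<in>prime_factors d. real (lam (p\<^sup>2)))"
    by (simp add: lam_square_squarefree[OF assms])
  also have "\<dots> \<le> (\<Prod>p\<in>prime_factors d. (if p < 8 then 2 else 1) * real p powr (1 / 3))"
  proof (rule prod_mono)
    fix p assume "p \<in> prime_factors d"
    hence p: "prime p" by auto
    have "real (lam (p\<^sup>2)) \<le> 2" using lam_prime_square_le[OF p] by simp
    also have "2 \<le> (if p < 8 then 2 else 1) * real p powr (1 / 3)"
      using two_le_powr_third[of "real p"] prime_ge_2_nat[OF p] by (auto intro!: ge_one_powr_ge_zero)
    finally show "0 \<le> real (lam (p\<^sup>2)) \<and> real (lam (p\<^sup>2)) \<le> (if p < 8 then 2 else 1) * real p powr (1 / 3)"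
      by simp
  qed
  also have "\<dots> = (\<Prod>p\<in>prime_factors d. if p < 8 then 2 else 1) * (\<Prod>p\<in>prime_factors d. real p powr (1 / 3))"
    by (rule prod.distrib)
  also have "(\<Prod>p\<in>prime_factors d. real p powr (1 / 3)) = (\<Prod>p\<in>prime_factors d. real p) powr (1 / 3)"
    by (rule prod_powr_distrib[symmetric])
  also have "(\<Prod>p\<in>prime_factors d. real p) = real d"
    by (simp add: prod_prime_factors_squarefree[OF assms] flip: of_nat_prod)
  also have "(\<Prod>p\<in>prime_factors d. if p < 8 then 2 else 1) = (2::real) ^ card {p \<in> prime_factors d. p < 8}"
    by (simp add: prod.inter_filter[symmetric])
  \<comment> \<open>A crude count of the small primes by all naturals below 8 gives the constant
    \<open>2 ^ 8 = 256\<close>.\<close>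
  also have "card {p \<in> prime_factors d. p < 8} \<le> card {..<8::nat}"
    by (intro card_mono) auto
  hence "(2::real) ^ card {p \<in> prime_factors d. p < 8} * real d powr (1 / 3) \<le> 2 ^ 8 * real d powr (1 / 3)"
    by (intro mult_right_mono power_increasing) auto
  finally show ?thesis by simp
qed

section \<open>The Euler product\<close>

text \<open>This is the term at \<open>d\<close> when the Euler product for
  \<open>sigma_const\<close> is multiplied out; \<open>N * euler_coeff d\<close> is the main term of
  the count for \<open>d\<close>.\<close>

definition euler_coeff :: "nat \<Rightarrow> real" where
  "euler_coeff d = real_of_int (moebius_mu d) * real (lam (d\<^sup>2)) / real (d\<^sup>2)"

text \<open>The value of the Riemann zeta function at 4/3; the term at 0 vanishes because
  \<open>0 powr a = 0\<close>.\<close>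

definition zeta_4_3 :: real where
  "zeta_4_3 = (\<Sum>n. real n powr (-4 / 3))"

lemma zeta_4_3_nonneg: "zeta_4_3 \<ge> 0"
  unfolding zeta_4_3_def by (rule suminf_nonneg) (auto simp: summable_real_powr_iff)

lemma abs_moebius_mult_lam_le: "\<bar>real_of_int (moebius_mu d) * real (lam (d\<^sup>2))\<bar> \<le> 256 * real d powr (1 / 3)"
proof (cases "squarefree d")
  case True
  have "\<bar>real_of_int (moebius_mu d) * real (lam (d\<^sup>2))\<bar> \<le> 1 * real (lam (d\<^sup>2))"
    unfolding abs_mult using abs_moebius_mu_le by (intro mult_mono) auto
  thus ?thesis using lam_square_le[OF True] by simp
next
  case False
  thus ?thesis by (simp add: moebius_mu_def)
qed

text \<open>The factor \<open>y powr (-1 / 3)\<close> is split off so that the rest sums to a constant over all \<open>d\<close>.\<close>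

lemma abs_euler_coeff_le:
  assumes "y > 0" "real d \<ge> y"
  shows "\<bar>euler_coeff d\<bar> \<le> 256 * y powr (-1 / 3) * real d powr (-4 / 3)"
proof -
  have d: "real d > 0" using assms by linarith
  have "\<bar>euler_coeff d\<bar> = \<bar>real_of_int (moebius_mu d) * real (lam (d\<^sup>2))\<bar> / real d powr 2"
    using d by (simp add: euler_coeff_def abs_mult)
  also have "\<dots> \<le> 256 * real d powr (1 / 3) / real d powr 2"
    by (intro divide_right_mono abs_moebius_mult_lam_le) simp
  also have "\<dots> = 256 * (real d powr (-1 / 3) * real d powr (-4 / 3))"
    using powr_diff[of "real d" "1 / 3" 2] powr_add[of "real d" "-1 / 3" "-4 / 3"] by simp
  also have "\<dots> \<le> 256 * (y powr (-1 / 3) * real d powr (-4 / 3))"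
    using assms d by (intro mult_left_mono mult_right_mono powr_mono2') auto
  finally show ?thesis by simp
qed

text \<open>The bound depends on \<open>y\<close> alone and not on the finite set \<open>D\<close>,
  so it survives the limit that leads to \<open>sigma_const\<close>.\<close>

lemma sum_abs_euler_coeff_le:
  assumes "y > 0" "finite D" "\<And>d. d \<in> D \<Longrightarrow> real d \<ge> y"
  shows "\<bar>sum euler_coeff D\<bar> \<le> 256 * zeta_4_3 * y powr (-1 / 3)"
proof -
  have "\<bar>sum euler_coeff D\<bar> \<le> (\<Sum>d\<in>D. \<bar>euler_coeff d\<bar>)" by (rule sum_abs)
  also have "\<dots> \<le> (\<Sum>d\<in>D. 256 * y powr (-1 / 3) * real d powr (-4 / 3))"
    by (intro sum_mono abs_euler_coeff_le assms)
  also have "\<dots> = 256 * y powr (-1 / 3) * (\<Sum>d\<in>D. real d powr (-4 / 3))"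
    by (simp add: sum_distrib_left)
  also have "\<dots> \<le> 256 * y powr (-1 / 3) * zeta_4_3"
    unfolding zeta_4_3_def
    by (intro mult_left_mono sum_le_suminf) (auto simp: summable_real_powr_iff assms)
  finally show ?thesis by (simp add: mult_ac)
qed

text \<open>Every factor differs from 1 by at most \<open>2 / p\<^sup>2\<close>, so the product
  converges absolutely.\<close>

lemma convergent_euler_factor: "convergent_prod euler_factor"
proof (intro abs_convergent_prod_imp_convergent_prod summable_imp_abs_convergent_prod)
  show "summable (\<lambda>p. norm (euler_factor p - 1))"
  proof (rule summable_comparison_test')
    show "summable (\<lambda>p. 2 * real p powr (-2))"
      by (intro summable_mult) (simp add: summable_real_powr_iff)
    fix p :: nat assume "p \<ge> 0"
    have "real (lam (p\<^sup>2)) / real (p\<^sup>2) \<le> 2 * real p powr (-2)" if "prime p"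
    proof -
      have "real (lam (p\<^sup>2)) / real (p\<^sup>2) \<le> 2 / real (p\<^sup>2)"
        using lam_prime_square_le[OF that] by (intro divide_right_mono) auto
      also have "\<dots> = 2 * real p powr (-2)"
        using prime_gt_0_nat[OF that] by (simp add: powr_minus divide_inverse)
      finally show ?thesis .
    qed
    thus "norm (norm (euler_factor p - 1)) \<le> 2 * real p powr (-2)"
      by (simp add: euler_factor_def)
  qed
qed

text \<open>No prime is a local obstruction: at most 2 of the \<open>p\<^sup>2 \<ge> 4\<close>
  residues are roots. Hence \<open>sigma_const\<close> is positive, which the infinitude claim
  relies on.\<close>

lemma euler_factor_pos: "euler_factor p > 0"
proof (cases "prime p")
  case True
  have "real (lam (p\<^sup>2)) \<le> 2" using lam_prime_square_le[OF True] by simp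
  also have "2 < real (p\<^sup>2)"
  proof -
    have "2 ^ 2 \<le> p\<^sup>2" using prime_ge_2_nat[OF True] by (intro power_mono) auto
    hence "real (2 ^ 2) \<le> real (p\<^sup>2)" by (simp only: of_nat_le_iff)
    thus ?thesis by simp
  qed
  finally show ?thesis using True prime_gt_0_nat[OF True] by (simp add: euler_factor_def)
qed (simp add: euler_factor_def)

lemma sigma_const_pos: "sigma_const > 0"
  unfolding sigma_const_def
  by (intro less_0_prodinf convergent_euler_factor euler_factor_pos)

lemma euler_factor_has_prod: "euler_factor has_prod sigma_const"
  unfolding sigma_const_def by (intro convergent_prod_has_prod convergent_euler_factor)

text \<open>For \<open>n \<ge> y\<close> the partial product up to \<open>n\<close> expands into a
  sum over square-free \<open>d\<close> with prime factors at most \<open>n\<close>. It contains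
  every nonzero term with \<open>d \<le> y\<close>; the others have \<open>d > y\<close> and form a
  tail bounded uniformly in \<open>n\<close>. Then \<open>n\<close> tends to infinity.\<close>

lemma sigma_const_approx:
  assumes "y > 0"
  shows "\<bar>sigma_const - (\<Sum>d | 1 \<le> d \<and> real d \<le> y. euler_coeff d)\<bar> \<le> 256 * zeta_4_3 * y powr (-1 / 3)"
proof -
  define E where "E = {d. 1 \<le> d \<and> real d \<le> y}"
  have finE: "finite E"
    by (rule finite_subset[of _ "{..nat \<lfloor>y\<rfloor>}"]) (auto simp: E_def le_nat_floor)
  have "\<bar>(\<Prod>i\<le>n. euler_factor i) - sum euler_coeff E\<bar> \<le> 256 * zeta_4_3 * y powr (-1 / 3)"
    if n: "real n \<ge> y" for n
  proof -
    define P where "P = {p. prime p \<and> p \<le> n}"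
    define S where "S = {d. squarefree d \<and> prime_factors d \<subseteq> P}"
    have P: "finite P" "\<And>p. p \<in> P \<Longrightarrow> prime p" by (auto simp: P_def)
    have finS: "finite S" unfolding S_def by (rule finite_squarefree_supported) (use P in auto)
    have "(\<Prod>i\<le>n. euler_factor i) = (\<Prod>p\<in>P. euler_factor p)"
      by (rule prod.mono_neutral_right) (auto simp: P_def euler_factor_def)
    also have "\<dots> = (\<Prod>p\<in>P. 1 - real (lam (p\<^sup>2)) / real (p\<^sup>2))"
      by (rule prod.cong) (auto simp: P_def euler_factor_def)
    also have "\<dots> = (\<Sum>d\<in>S. real_of_int (moebius_mu d) * (\<Prod>p\<in>prime_factors d. real (lam (p\<^sup>2)) / real (p\<^sup>2)))"
      unfolding S_def by (rule prod_one_minus_primes) (use P in auto)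
    also have "\<dots> = (\<Sum>d\<in>S. euler_coeff d)"
    proof (rule sum.cong)
      fix d assume "d \<in> S"
      hence d: "squarefree d" by (simp add: S_def)
      have "(\<Prod>p\<in>prime_factors d. real (p\<^sup>2)) = real ((\<Prod>(prime_factors d))\<^sup>2)"
        unfolding of_nat_prod[symmetric] prod_power_distrib ..
      hence "(\<Prod>p\<in>prime_factors d. real (p\<^sup>2)) = real (d\<^sup>2)"
        unfolding prod_prime_factors_squarefree[OF d] .
      moreover have "(\<Prod>p\<in>prime_factors d. real (lam (p\<^sup>2))) = real (lam (d\<^sup>2))"
        by (simp add: lam_square_squarefree[OF d])
      ultimately show "real_of_int (moebius_mu d) * (\<Prod>p\<in>prime_factors d. real (lam (p\<^sup>2)) / real (p\<^sup>2)) = euler_coeff d"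
        by (simp only: prod_dividef euler_coeff_def times_divide_eq_right)
    qed simp
    also have "\<dots> = (\<Sum>d\<in>S \<inter> E. euler_coeff d) + (\<Sum>d\<in>S - E. euler_coeff d)"
      by (rule sum.Int_Diff[OF finS])
    \<comment> \<open>Prime factors of \<open>d \<le> y\<close> are at most \<open>n\<close>, so an
      element of \<open>E\<close> outside \<open>S\<close> is not square-free and has coefficient
      0.\<close>
    also have "(\<Sum>d\<in>S \<inter> E. euler_coeff d) = sum euler_coeff E"
    proof (rule sum.mono_neutral_left)
      show "\<forall>i\<in>E - S \<inter> E. euler_coeff i = 0"
      proof
        fix i assume i: "i \<in> E - S \<inter> E"
        have "prime_factors i \<subseteq> P"
          using i n by (auto simp: P_def E_def in_prime_factors_iff dest!: dvd_imp_le)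
        hence "\<not> squarefree i" using i by (auto simp: S_def)
        thus "euler_coeff i = 0" by (simp add: euler_coeff_def moebius_mu_def)
      qed
    qed (use finE in auto)
    finally have "(\<Prod>i\<le>n. euler_factor i) - sum euler_coeff E = (\<Sum>d\<in>S - E. euler_coeff d)" by simp
    moreover have "\<bar>\<Sum>d\<in>S - E. euler_coeff d\<bar> \<le> 256 * zeta_4_3 * y powr (-1 / 3)"
    proof (rule sum_abs_euler_coeff_le)
      fix d assume "d \<in> S - E"
      hence "d \<noteq> 0" "d \<notin> E" by (auto simp: S_def intro: Nat.gr0I)
      thus "real d \<ge> y" by (auto simp: E_def)
    qed (use finS assms in auto)
    ultimately show ?thesis by simp
  qed
  hence "eventually (\<lambda>n. \<bar>(\<Prod>i\<le>n. euler_factor i) - sum euler_coeff E\<bar> \<le> 256 * zeta_4_3 * y powr (-1 / 3)) sequentially"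
    by (intro eventually_mono[OF eventually_ge_at_top[of "nat \<lceil>y\<rceil>"]]) (auto simp: nat_le_iff ceiling_le_iff)
  moreover have "(\<lambda>n. \<bar>(\<Prod>i\<le>n. euler_factor i) - sum euler_coeff E\<bar>) \<longlonglongrightarrow> \<bar>sigma_const - sum euler_coeff E\<bar>"
    unfolding sigma_const_def
    by (intro tendsto_intros convergent_prod_LIMSEQ convergent_euler_factor)
  ultimately show ?thesis unfolding E_def
    by (intro tendsto_upperbound[OF _ _ trivial_limit_sequentially])
qed

section \<open>A Pell-type equation\<close>

text \<open>Both numbers have norm -3, and the congruences make their quotient
  \<open>u + v * s\<close> have integral \<open>u\<close> and \<open>v\<close>. The quotient exceeds
  1 while its conjugate lies between 0 and 1, so \<open>u\<close> and \<open>v\<close> are at least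
  1 and the quotient is at least \<open>1 + s \<ge> 2\<close>.\<close>

lemma pell_ratio_ge_2:
  fixes x1 y1 x2 y2 k :: int
  assumes eq1: "x1\<^sup>2 - k * y1\<^sup>2 = -3" and eq2: "x2\<^sup>2 - k * y2\<^sup>2 = -3"
    and pos: "x1 > 0" "y1 > 0" "x2 > 0" "y2 > 0" "k > 0"
    and cong: "[x1 = x2] (mod 3)" "[y1 = y2] (mod 3)"
    and less: "x1 + y1 * sqrt k < x2 + y2 * sqrt k"
  shows "2 * (x1 + y1 * sqrt k) \<le> x2 + y2 * sqrt k"
proof -
  define s where "s = sqrt k"
  have ss: "s * s = k" and s1: "s \<ge> 1" using pos by (simp_all add: s_def)
  define z1 z2 where "z1 = x1 + y1 * s" and "z2 = x2 + y2 * s"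
  have zpos: "z1 > 0" "z2 > 0" using pos s1 by (simp_all add: z1_def z2_def add_pos_pos)
  have zless: "z1 < z2" using less by (simp add: z1_def z2_def s_def)
  \<comment> \<open>Modulo 3 the second solution may be replaced by the first, which leaves minus
    the norm, that is 3.\<close>
  have "[k * y1 * y2 - x1 * x2 = k * y1 * y1 - x1 * x1] (mod 3)"
    by (intro cong_diff cong_mult cong_refl cong_sym[OF cong(1)] cong_sym[OF cong(2)])
  moreover have "k * y1 * y1 - x1 * x1 = 3" using eq1 by (simp add: power2_eq_square algebra_simps)
  ultimately have "3 dvd k * y1 * y2 - x1 * x2" by (simp add: cong_def dvd_eq_mod_eq_0)
  \<comment> \<open>\<open>u + v * s\<close> is the quotient \<open>z2 / z1\<close>, and \<open>u - v * s\<close> its inverse.\<close>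
  then obtain u where u: "k * y1 * y2 - x1 * x2 = 3 * u" by blast
  have "[x2 * y1 - x1 * y2 = x1 * y1 - x1 * y1] (mod 3)"
    by (intro cong_diff cong_mult cong_refl cong_sym[OF cong(1)] cong_sym[OF cong(2)])
  hence "3 dvd x2 * y1 - x1 * y2" by (simp add: cong_0_iff)
  then obtain v where v: "x2 * y1 - x1 * y2 = 3 * v" by blast
  have u': "3 * real_of_int u = s * s * y1 * y2 - x1 * x2"
    unfolding ss using u by (metis of_int_diff of_int_mult of_int_numeral)
  have v': "3 * real_of_int v = x2 * y1 - real_of_int x1 * y2"
    using v by (metis of_int_diff of_int_mult of_int_numeral)
  have e1: "real_of_int x1 * x1 - s * s * y1 * y1 = -3"
    unfolding ss using eq1 by (metis (no_types, lifting) of_int_diff of_int_minus of_int_mult of_int_numeral power2_eq_square mult.assoc)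
  have e2: "real_of_int x2 * x2 - s * s * y2 * y2 = -3"
    unfolding ss using eq2 by (metis (no_types, lifting) of_int_diff of_int_minus of_int_mult of_int_numeral power2_eq_square mult.assoc)
  have "3 * (z1 * (u + v * s)) = (x1 + y1 * s) * (3 * real_of_int u + 3 * real_of_int v * s)"
    by (simp add: z1_def algebra_simps)
  also have "\<dots> = - (real_of_int x1 * x1 - s * s * y1 * y1) * (x2 + y2 * s)"
    unfolding u' v' by (simp add: algebra_simps)
  also have "\<dots> = 3 * z2" unfolding e1 z2_def by simp
  finally have r1: "z1 * (u + v * s) = z2" by simp
  have "3 * (z2 * (u - v * s)) = (x2 + y2 * s) * (3 * real_of_int u - 3 * real_of_int v * s)"
    by (simp add: z2_def algebra_simps)
  also have "\<dots> = - (real_of_int x2 * x2 - s * s * y2 * y2) * (x1 + y1 * s)"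
    unfolding u' v' by (simp add: algebra_simps)
  also have "\<dots> = 3 * z1" unfolding e2 z1_def by simp
  finally have r2: "z2 * (u - v * s) = z1" by simp
  have a: "u + v * s > 1"
  proof (rule ccontr)
    assume "\<not> u + v * s > 1"
    hence "z1 * (u + v * s) \<le> z1 * 1" using zpos by (intro mult_left_mono) auto
    thus False using r1 zless by simp
  qed
  have b: "u - v * s < 1"
  proof (rule ccontr)
    assume "\<not> u - v * s < 1"
    hence "z2 * (u - v * s) \<ge> z2 * 1" using zpos by (intro mult_left_mono) auto
    thus False using r2 zless by simp
  qed
  have c: "u - v * s > 0" using r2 zpos by (metis zero_less_mult_pos)
  \<comment> \<open>Adding \<open>a\<close> and \<open>c\<close> isolates \<open>u\<close>, and
    comparing \<open>a\<close> with \<open>b\<close> isolates \<open>v\<close>; integrality raises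
    both from positive to at least 1.\<close>
  have "u \<ge> 1"
  proof -
    have "real_of_int u > 0" using a c by linarith
    thus ?thesis by simp
  qed
  moreover have "v \<ge> 1"
  proof -
    have "v * s > 0" using a b by linarith
    hence "real_of_int v > 0" using s1 by (simp add: zero_less_mult_iff)
    thus ?thesis by simp
  qed
  ultimately have "u + v * s \<ge> 1 + 1 * 1" using s1 by (intro add_mono mult_mono) auto
  hence "z1 * 2 \<le> z1 * (u + v * s)" using zpos by (intro mult_left_mono) auto
  thus ?thesis using r1 by (simp add: z1_def z2_def s_def)
qed

text \<open>Equal floors place \<open>z\<close> and \<open>w\<close> in the same dyadic
  interval.\<close>

lemma floor_log_eq_imp_ratio_less_2:
  assumes "z > 0" "w > 0" "\<lfloor>log 2 z\<rfloor> = \<lfloor>log 2 w\<rfloor>"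
  shows "w < 2 * z"
proof -
  have "log 2 w < log 2 z + 1" using assms by linarith
  also have "\<dots> = log 2 (2 * z)" using assms by (simp add: log_mult)
  finally show ?thesis using assms by simp
qed

text \<open>The map \<open>h\<close> records the residues of \<open>2 * n + 1\<close> and
  \<open>2 * d\<close> modulo 3 and the dyadic interval of the size \<open>z\<close>. Solutions
  sharing all three have equal size by \<open>pell_ratio_ge_2\<close>, so there are at most 9 per
  dyadic interval.\<close>

lemma card_pell_solutions_le:
  assumes "k > 0" "N > 0"
  shows "real (card {(n, d). n \<in> {1..N} \<and> d > 0 \<and> quad n = k * d\<^sup>2}) \<le> 9 * (1 + log 2 (7 * real N))"
    and "finite {(n, d). n \<in> {1..N} \<and> d > 0 \<and> quad n = k * d\<^sup>2}"
proof -
  define A where "A = {(n, d). n \<in> {1..N} \<and> d > 0 \<and> quad n = k * d\<^sup>2}"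
  define z where "z = (\<lambda>(n, d). real (2 * n + 1) + real (2 * d) * sqrt k)"
  define L where "L = \<lfloor>log 2 (7 * real N)\<rfloor>"
  define h where "h = (\<lambda>(n, d). ((2 * int n + 1) mod 3, (2 * int d) mod 3, \<lfloor>log 2 (z (n, d))\<rfloor>))"
  \<comment> \<open>Completing the square:
    \<open>4 * quad n = (2 * n + 1)\<^sup>2 + 3\<close>.\<close>
  have eq: "(2 * int n + 1)\<^sup>2 - int k * (2 * int d)\<^sup>2 = -3" if "(n, d) \<in> A" for n d
  proof -
    have "int (quad n) = int (k * d\<^sup>2)" using that by (simp add: A_def)
    thus ?thesis by (simp add: int_quad power2_eq_square algebra_simps)
  qed
  have z_ge: "z (n, d) \<ge> 1" for n d by (simp add: z_def)
  \<comment> \<open>The irrational part is at most \<open>2 * n + 2\<close>, so \<open>z\<close> is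
    at most \<open>4 * n + 3 \<le> 7 * N\<close>.\<close>
  have z_le: "z (n, d) \<le> 7 * N" if "(n, d) \<in> A" for n d
  proof -
    have "real_of_int ((2 * int n + 1)\<^sup>2 - int k * (2 * int d)\<^sup>2) = -3" using eq[OF that] by simp
    hence "(real (2 * d) * sqrt k)\<^sup>2 = real (2 * n + 1)^2 + 3"
      by (simp add: power_mult_distrib algebra_simps)
    also have "\<dots> \<le> real (2 * n + 2)^2" using that by (simp add: power2_eq_square algebra_simps A_def)
    finally have "real (2 * d) * sqrt k \<le> real (2 * n + 2)" by (rule power2_le_imp_le) simp
    thus ?thesis using that by (simp add: z_def A_def)
  qed
  have inj: "inj_on h A"
  proof (rule inj_onI)
    have z_not_less: "\<not> z (n, d) < z (m, e)" if "(n, d) \<in> A" "(m, e) \<in> A" "h (n, d) = h (m, e)" for n d m e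
    proof
      assume less: "z (n, d) < z (m, e)"
      have "2 * (real_of_int (2 * int n + 1) + real_of_int (2 * int d) * sqrt (int k))
        \<le> real_of_int (2 * int m + 1) + real_of_int (2 * int e) * sqrt (int k)"
        by (rule pell_ratio_ge_2[OF eq[OF that(1)] eq[OF that(2)]])
          (use that less assms in \<open>auto simp: A_def h_def cong_def z_def\<close>)
      hence "2 * z (n, d) \<le> z (m, e)" by (simp add: z_def)
      moreover have "z (m, e) < 2 * z (n, d)"
      proof (rule floor_log_eq_imp_ratio_less_2)
        show "z (n, d) > 0" "z (m, e) > 0" using z_ge[of n d] z_ge[of m e] by linarith+
        show "\<lfloor>log 2 (z (n, d))\<rfloor> = \<lfloor>log 2 (z (m, e))\<rfloor>" using that(3) by (simp add: h_def)
      qed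
      ultimately show False by simp
    qed
    fix a b assume ab: "a \<in> A" "b \<in> A" "h a = h b"
    obtain n d m e where nd: "a = (n, d)" "b = (m, e)" by (cases a, cases b) auto
    have zz: "z (n, d) = z (m, e)"
      using z_not_less[of n d m e] z_not_less[of m e n d] ab nd by fastforce
    \<comment> \<open>For fixed \<open>k\<close>, a larger \<open>n\<close> forces a
      \<open>d\<close> at least as large, so \<open>z\<close> increases strictly with
      \<open>n\<close> and equal sizes give equal solutions.\<close>
    have "n = m"
    proof (rule ccontr)
      have *: "z (n, d) < z (m, e)" if "(n, d) \<in> A" "(m, e) \<in> A" "n < m" for n d m e
      proof -
        have "quad n \<le> quad m" unfolding quad_def using that by (intro add_mono power_mono) auto
        moreover have "quad n = k * d\<^sup>2" "quad m = k * e\<^sup>2"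
          using that by (simp_all add: A_def)
        ultimately have "k * d\<^sup>2 \<le> k * e\<^sup>2" by (simp only:)
        hence "d \<le> e" using assms by (simp add: power2_nat_le_eq_le)
        hence "real (2 * d) * sqrt k \<le> real (2 * e) * sqrt k" by (intro mult_right_mono) auto
        thus ?thesis using that by (simp add: z_def)
      qed
      assume "n \<noteq> m"
      thus False using *[of n d m e] *[of m e n d] zz ab nd by fastforce
    qed
    moreover from this have "k * d\<^sup>2 = k * e\<^sup>2" using ab nd by (simp add: A_def)
    hence "d = e" using assms by simp
    ultimately show "a = b" using nd by simp
  qed
  have img: "h ` A \<subseteq> {0..2} \<times> {0..2} \<times> {0..L}"
  proof (rule image_subsetI)
    fix a assume a: "a \<in> A"
    obtain n d where a_eq: "a = (n, d)" by (cases a)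
    with a have nd: "(n, d) \<in> A" by simp
    have "0 \<le> \<lfloor>log 2 (z (n, d))\<rfloor>" using z_ge[of n d] by simp
    moreover have "\<lfloor>log 2 (z (n, d))\<rfloor> \<le> L" unfolding L_def
      using z_ge[of n d] z_le[OF nd] by (intro floor_mono) simp
    moreover have "(2 * int n + 1) mod 3 \<le> 2" "(2 * int d) mod 3 \<le> 2"
      using pos_mod_bound[of 3 "2 * int n + 1"] pos_mod_bound[of 3 "2 * int d"] by linarith+
    ultimately show "h a \<in> {0..2} \<times> {0..2} \<times> {0..L}" by (simp add: h_def a_eq)
  qed
  have fin: "finite A" using inj img by (rule inj_on_finite) simp
  thus "finite {(n, d). n \<in> {1..N} \<and> d > 0 \<and> quad n = k * d\<^sup>2}" by (simp add: A_def)
  have "card A = card (h ` A)" using inj by (simp add: card_image)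
  also have "\<dots> \<le> card ({0..2::int} \<times> {0..2::int} \<times> {0..L})" using img by (intro card_mono) auto
  also have "\<dots> = 9 * nat (L + 1)" by (simp add: card_cartesian_product)
  finally have "real (card A) \<le> 9 * real (nat (L + 1))" by (metis of_nat_le_iff of_nat_mult of_nat_numeral)
  also have "real (nat (L + 1)) \<le> 1 + log 2 (7 * real N)"
  proof -
    have "log 2 (7 * real N) \<ge> 0" using assms by simp
    hence "L \<ge> 0" unfolding L_def by simp
    hence "real (nat (L + 1)) = real_of_int L + 1" by simp
    thus ?thesis unfolding L_def by linarith
  qed
  finally show "real (card {(n, d). n \<in> {1..N} \<and> d > 0 \<and> quad n = k * d\<^sup>2}) \<le> 9 * (1 + log 2 (7 * real N))"
    by (simp add: A_def)
qed

section \<open>The asymptotic formula\<close>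

text \<open>For positive \<open>n\<close> the value \<open>quad n\<close> lies below
  \<open>(n + 1)\<^sup>2\<close>. This lets the divisor sum stop at \<open>N\<close>.\<close>

lemma square_dvd_quad_imp_le:
  assumes "d\<^sup>2 dvd quad n" "n > 0"
  shows "d \<le> n"
proof (rule ccontr)
  assume "\<not> d \<le> n"
  hence "(n + 1)\<^sup>2 \<le> d\<^sup>2" by (intro power_mono) auto
  also have "d\<^sup>2 \<le> quad n" using assms(1) by (rule dvd_imp_le) (simp add: quad_def)
  finally show False using assms(2) by (simp add: quad_def power2_eq_square)
qed

lemma card_squarefree_quad_eq_sum:
  "real (card {n \<in> {1..N}. squarefree (quad n)}) =
    (\<Sum>d\<in>{1..N}. real_of_int (moebius_mu d) * real (card {n \<in> {1..N}. d\<^sup>2 dvd quad n}))"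
proof -
  have "real (card {n \<in> {1..N}. squarefree (quad n)}) = (\<Sum>n\<in>{1..N}. if squarefree (quad n) then 1 else 0)"
    by (simp add: sum.inter_filter[symmetric])
  also have "\<dots> = (\<Sum>n\<in>{1..N}. \<Sum>d\<in>{1..N}. if d\<^sup>2 dvd quad n then real_of_int (moebius_mu d) else 0)"
  proof (rule sum.cong)
    fix n assume n: "n \<in> {1..N}"
    have "(if squarefree (quad n) then 1 else 0) = (\<Sum>d | squarefree d \<and> d\<^sup>2 dvd quad n. real_of_int (moebius_mu d))"
      by (rule sum_moebius_square_dvd[symmetric]) (simp add: quad_def)
    also have "\<dots> = (\<Sum>d\<in>{d \<in> {1..N}. d\<^sup>2 dvd quad n}. real_of_int (moebius_mu d))"
    proof (rule sum.mono_neutral_left)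
      show "{d. squarefree d \<and> d\<^sup>2 dvd quad n} \<subseteq> {d \<in> {1..N}. d\<^sup>2 dvd quad n}"
      proof
        fix d assume d: "d \<in> {d. squarefree d \<and> d\<^sup>2 dvd quad n}"
        hence "d \<noteq> 0" by (auto intro: Nat.gr0I)
        moreover have "d \<le> N" using d square_dvd_quad_imp_le[of d n] n by auto
        ultimately show "d \<in> {d \<in> {1..N}. d\<^sup>2 dvd quad n}" using d by auto
      qed
    qed (auto simp: moebius_mu_def)
    also have "\<dots> = (\<Sum>d\<in>{1..N}. if d\<^sup>2 dvd quad n then real_of_int (moebius_mu d) else 0)"
      by (rule sum.inter_filter) simp
    finally show "(if squarefree (quad n) then 1 else 0) =
      (\<Sum>d\<in>{1..N}. if d\<^sup>2 dvd quad n then real_of_int (moebius_mu d) else 0)" .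
  qed simp
  also have "\<dots> = (\<Sum>d\<in>{1..N}. \<Sum>n\<in>{1..N}. if d\<^sup>2 dvd quad n then real_of_int (moebius_mu d) else 0)"
    by (rule sum.swap)
  also have "\<dots> = (\<Sum>d\<in>{1..N}. real_of_int (moebius_mu d) * real (card {n \<in> {1..N}. d\<^sup>2 dvd quad n}))"
  proof (rule sum.cong)
    fix d
    have "(\<Sum>n\<in>{1..N}. if d\<^sup>2 dvd quad n then real_of_int (moebius_mu d) else 0) =
        (\<Sum>n\<in>{n \<in> {1..N}. d\<^sup>2 dvd quad n}. real_of_int (moebius_mu d))"
      by (rule sum.inter_filter[symmetric]) simp
    thus "(\<Sum>n\<in>{1..N}. if d\<^sup>2 dvd quad n then real_of_int (moebius_mu d) else 0) =
        real_of_int (moebius_mu d) * real (card {n \<in> {1..N}. d\<^sup>2 dvd quad n})"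
      by simp
  qed simp
  finally show ?thesis .
qed

text \<open>The sum counts pairs \<open>(d, n)\<close>. Grouping them by the cofactor
  \<open>k = quad n / d\<^sup>2\<close>, which is at most \<open>3 * N\<^sup>2 / y\<^sup>2\<close>,
  leaves the solutions of one Pell-type equation for each \<open>k\<close>.\<close>

lemma sum_card_large_square_divisors_le:
  assumes "N > 0" "y > 0"
  shows "(\<Sum>d\<in>{d \<in> {1..N}. real d > y}. real (card {n \<in> {1..N}. d\<^sup>2 dvd quad n}))
    \<le> 3 * (real N)\<^sup>2 / y\<^sup>2 * (9 * (1 + log 2 (7 * real N)))"
proof -
  define K where "K = nat \<lfloor>3 * (real N)\<^sup>2 / y\<^sup>2\<rfloor>"
  define A where "A = (\<lambda>k. {(n, d). n \<in> {1..N} \<and> d > 0 \<and> quad n = k * d\<^sup>2})"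
  define B where "B = (SIGMA d:{d \<in> {1..N}. real d > y}. {n \<in> {1..N}. d\<^sup>2 dvd quad n})"
  have finA: "finite (A k)" if "k > 0" for k
    unfolding A_def by (rule card_pell_solutions_le(2)[OF that assms(1)])
  have "B \<subseteq> prod.swap ` (\<Union>k\<in>{1..K}. A k)"
  proof
    fix t assume "t \<in> B"
    then obtain d n where t: "t = (d, n)" "d \<in> {1..N}" "real d > y" "n \<in> {1..N}" "d\<^sup>2 dvd quad n"
      by (auto simp: B_def)
    then obtain k where k: "quad n = d\<^sup>2 * k" by blast
    have "k \<noteq> 0" using k by (intro notI) (simp add: quad_def)
    have "quad n \<le> N * N + N * N + N * N"
      unfolding quad_def power2_eq_square using t by (intro add_mono mult_mono) (auto intro: order_trans[OF _ le_square])
    hence "real (quad n) \<le> 3 * (real N)\<^sup>2"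
      by (simp add: power2_eq_square flip: of_nat_mult of_nat_add)
    have "real k * y\<^sup>2 \<le> real k * (real d)\<^sup>2"
      using t assms by (intro mult_left_mono power_mono) auto
    also have "\<dots> = real (quad n)" using k by simp
    also have "\<dots> \<le> 3 * (real N)\<^sup>2" by fact
    finally have "real k \<le> 3 * (real N)\<^sup>2 / y\<^sup>2" using assms by (simp add: field_simps)
    hence "k \<le> K" unfolding K_def by (rule le_nat_floor)
    moreover have "(n, d) \<in> A k" using t k by (auto simp: A_def)
    ultimately have "(n, d) \<in> (\<Union>k\<in>{1..K}. A k)" using \<open>k \<noteq> 0\<close> by (intro UN_I[of k]) auto
    thus "t \<in> prod.swap ` (\<Union>k\<in>{1..K}. A k)" using t by (intro image_eqI[of _ _ "(n, d)"]) auto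
  qed
  hence "card B \<le> card (prod.swap ` (\<Union>k\<in>{1..K}. A k))"
    using finA by (intro card_mono) auto
  also have "\<dots> \<le> card (\<Union>k\<in>{1..K}. A k)"
    using finA by (intro card_image_le) auto
  also have "\<dots> \<le> (\<Sum>k\<in>{1..K}. card (A k))" by (intro card_UN_le) simp
  finally have "real (card B) \<le> (\<Sum>k\<in>{1..K}. real (card (A k)))"
    by (simp only: of_nat_le_iff flip: of_nat_sum)
  also have "\<dots> \<le> (\<Sum>k\<in>{1..K}. 9 * (1 + log 2 (7 * real N)))"
    unfolding A_def by (intro sum_mono card_pell_solutions_le(1)) (use assms in auto)
  also have "\<dots> = real K * (9 * (1 + log 2 (7 * real N)))" by simp
  also have "\<dots> \<le> 3 * (real N)\<^sup>2 / y\<^sup>2 * (9 * (1 + log 2 (7 * real N)))"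
  proof (rule mult_right_mono)
    show "real K \<le> 3 * (real N)\<^sup>2 / y\<^sup>2" unfolding K_def by (intro of_nat_floor) simp
    show "0 \<le> 9 * (1 + log 2 (7 * real N))" using assms by simp
  qed
  finally show ?thesis unfolding B_def by (subst (asm) card_SigmaI) auto
qed

lemma card_nat_le_real:
  assumes "y \<ge> 0"
  shows "real (card {d. 1 \<le> d \<and> real d \<le> y}) \<le> y" "finite {d. 1 \<le> d \<and> real d \<le> y}"
proof -
  have eq: "{d. 1 \<le> d \<and> real d \<le> y} = {1..nat \<lfloor>y\<rfloor>}"
    using assms by (auto simp: le_nat_iff le_floor_iff)
  show "finite {d. 1 \<le> d \<and> real d \<le> y}" unfolding eq by simp
  show "real (card {d. 1 \<le> d \<and> real d \<le> y}) \<le> y" unfolding eq using assms by (simp add: of_nat_floor)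
qed

text \<open>The three error terms come, in order, from rounding in the counts for
  \<open>d \<le> y\<close>, from truncating the Euler expansion at \<open>y\<close>, and from the
  divisors \<open>d > y\<close>.\<close>

lemma card_squarefree_quad_approx:
  assumes "N > 0" "y > 0" "y \<le> real N"
  shows "\<bar>real (card {n \<in> {1..N}. squarefree (quad n)}) - sigma_const * real N\<bar>
    \<le> 256 * (y * y powr (1 / 3)) + 256 * zeta_4_3 * (real N * y powr (-1 / 3)) +
      27 * ((real N)\<^sup>2 / y\<^sup>2 * (1 + log 2 (7 * real N)))"
proof -
  define r where "r = (\<lambda>d. real (card {n \<in> {1..N}. d\<^sup>2 dvd quad n}))"
  define E where "E = {d. 1 \<le> d \<and> real d \<le> y}"
  define F where "F = {d \<in> {1..N}. real d > y}"
  define \<mu> where "\<mu> = (\<lambda>d. real_of_int (moebius_mu d))"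
  have fin: "finite E" "finite F" using card_nat_le_real(2)[of y] assms by (auto simp: E_def F_def)
  have "real (card {n \<in> {1..N}. squarefree (quad n)}) = (\<Sum>d\<in>{1..N}. \<mu> d * r d)"
    unfolding \<mu>_def r_def by (rule card_squarefree_quad_eq_sum)
  also have "\<dots> = (\<Sum>d\<in>E \<union> F. \<mu> d * r d)"
    by (rule sum.cong) (use assms in \<open>auto simp: E_def F_def\<close>)
  also have "\<dots> = (\<Sum>d\<in>E. \<mu> d * r d) + (\<Sum>d\<in>F. \<mu> d * r d)"
    by (rule sum.union_disjoint) (use fin in \<open>auto simp: E_def F_def\<close>)
  also have "(\<Sum>d\<in>E. \<mu> d * r d) = (\<Sum>d\<in>E. \<mu> d * r d - real N * euler_coeff d) + real N * sum euler_coeff E"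
    by (simp add: sum_subtractf sum_distrib_left)
  finally have split: "real (card {n \<in> {1..N}. squarefree (quad n)}) - sigma_const * real N =
    (\<Sum>d\<in>E. \<mu> d * r d - real N * euler_coeff d) - real N * (sigma_const - sum euler_coeff E) + (\<Sum>d\<in>F. \<mu> d * r d)"
    by (simp add: algebra_simps)
  have t1: "\<bar>\<Sum>d\<in>E. \<mu> d * r d - real N * euler_coeff d\<bar> \<le> 256 * (y * y powr (1 / 3))"
  proof -
    have "\<bar>\<Sum>d\<in>E. \<mu> d * r d - real N * euler_coeff d\<bar> \<le> (\<Sum>d\<in>E. \<bar>\<mu> d * r d - real N * euler_coeff d\<bar>)"
      by (rule sum_abs)
    also have "\<dots> \<le> (\<Sum>d\<in>E. 256 * y powr (1 / 3))"
    proof (rule sum_mono)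
      fix d assume d: "d \<in> E"
      have "\<bar>\<mu> d * r d - real N * euler_coeff d\<bar> = \<bar>\<mu> d * (r d - real N * real (lam (d\<^sup>2)) / real (d\<^sup>2))\<bar>"
        by (simp add: \<mu>_def euler_coeff_def algebra_simps)
      also have "\<dots> \<le> \<bar>\<mu> d * real (lam (d\<^sup>2))\<bar>"
        unfolding abs_mult using card_quad_approx[of "d\<^sup>2" N] d
        by (intro mult_left_mono) (auto simp: r_def E_def)
      also have "\<dots> \<le> 256 * real d powr (1 / 3)" unfolding \<mu>_def by (rule abs_moebius_mult_lam_le)
      also have "\<dots> \<le> 256 * y powr (1 / 3)" using d by (intro mult_left_mono powr_mono2) (auto simp: E_def)
      finally show "\<bar>\<mu> d * r d - real N * euler_coeff d\<bar> \<le> 256 * y powr (1 / 3)" .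
    qed
    also have "\<dots> = real (card E) * (256 * y powr (1 / 3))" by simp
    also have "\<dots> \<le> y * (256 * y powr (1 / 3))"
      unfolding E_def using assms by (intro mult_right_mono card_nat_le_real) auto
    finally show ?thesis by simp
  qed
  have t2: "\<bar>real N * (sigma_const - sum euler_coeff E)\<bar> \<le> 256 * zeta_4_3 * (real N * y powr (-1 / 3))"
  proof -
    have "real N * \<bar>sigma_const - sum euler_coeff E\<bar> \<le> real N * (256 * zeta_4_3 * y powr (-1 / 3))"
      unfolding E_def by (intro mult_left_mono sigma_const_approx assms) simp
    thus ?thesis by (simp add: abs_mult mult_ac)
  qed
  have t3: "\<bar>\<Sum>d\<in>F. \<mu> d * r d\<bar> \<le> 27 * ((real N)\<^sup>2 / y\<^sup>2 * (1 + log 2 (7 * real N)))"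
  proof -
    have "\<bar>\<Sum>d\<in>F. \<mu> d * r d\<bar> \<le> (\<Sum>d\<in>F. \<bar>\<mu> d * r d\<bar>)" by (rule sum_abs)
    also have "\<dots> \<le> (\<Sum>d\<in>F. 1 * r d)"
      unfolding abs_mult \<mu>_def by (intro sum_mono mult_mono abs_moebius_mu_le) (auto simp: r_def)
    also have "\<dots> \<le> 3 * (real N)\<^sup>2 / y\<^sup>2 * (9 * (1 + log 2 (7 * real N)))"
      unfolding F_def r_def mult_1 by (rule sum_card_large_square_divisors_le) (use assms in auto)
    also have "\<dots> = 27 * ((real N)\<^sup>2 / y\<^sup>2 * (1 + log 2 (7 * real N)))"
      by (simp add: algebra_simps add_divide_distrib)
    finally show ?thesis .
  qed
  show ?thesis unfolding split using t1 t2 t3 by linarith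
qed

text \<open>The choice \<open>y = N powr (3 / 5)\<close> balances the errors:
  \<open>y powr (4 / 3)\<close>, \<open>N * y powr (-1 / 3)\<close> and
  \<open>N\<^sup>2 / y\<^sup>2\<close> all equal \<open>N powr (4 / 5)\<close>. Since the
  logarithmic factor is at least 1, the constants add up, with
  \<open>283 = 256 + 27\<close>.\<close>

lemma card_squarefree_quad_error:
  assumes "N > 0"
  shows "\<bar>real (card {n \<in> {1..N}. squarefree (quad n)}) - sigma_const * real N\<bar>
    \<le> (283 + 256 * zeta_4_3) * (real N powr (4 / 5) * (1 + log 2 (7 * real N)))"
proof -
  define y where "y = real N powr (3 / 5)"
  define M where "M = real N powr (4 / 5)"
  define L where "L = 1 + log 2 (7 * real N)"
  have N: "real N \<ge> 1" using assms by simp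
  have y: "y > 0" "y \<le> real N"
    using N powr_mono[of "3 / 5" 1 "real N"] by (simp_all add: y_def)
  have L: "L \<ge> 1" using N by (simp add: L_def)
  have M: "M \<ge> 0" by (simp add: M_def)
  have "y * y powr (1 / 3) = M"
    unfolding y_def M_def powr_powr powr_add[symmetric] by simp
  moreover have "real N * y powr (-1 / 3) = M"
    using N powr_add[of "real N" 1 "-1 / 5"] by (simp add: y_def M_def powr_powr)
  moreover have "(real N)\<^sup>2 / y\<^sup>2 = M"
  proof -
    have "(real N)\<^sup>2 = real N powr 2" using N by simp
    moreover have "y\<^sup>2 = real N powr (6 / 5)"
      using powr_add[of "real N" "3 / 5" "3 / 5"] by (simp add: y_def power2_eq_square)
    ultimately show ?thesis by (simp add: M_def powr_diff[symmetric] del: powr_numeral)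
  qed
  ultimately have "\<bar>real (card {n \<in> {1..N}. squarefree (quad n)}) - sigma_const * real N\<bar>
    \<le> 256 * M + 256 * zeta_4_3 * M + 27 * (M * L)"
    using card_squarefree_quad_approx[OF assms y] by (simp add: L_def)
  also have "\<dots> \<le> 256 * (M * L) + 256 * zeta_4_3 * (M * L) + 27 * (M * L)"
  proof -
    have M_le: "M \<le> M * L" using mult_left_mono[OF L M] by simp
    have "256 * zeta_4_3 * M \<le> 256 * zeta_4_3 * (M * L)"
      using M_le M zeta_4_3_nonneg by (intro mult_mono) auto
    with M_le show ?thesis by linarith
  qed
  finally show ?thesis by (simp add: M_def L_def algebra_simps)
qed

section \<open>Passage to real \<open>X\<close> and consequences\<close>

lemma Gamma_sum_eq_card: "Gamma_sum X = real (card {n \<in> {1..nat \<lfloor>X\<rfloor>}. squarefree (quad n)})"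
proof -
  have "{n. 1 \<le> n \<and> real n \<le> X} = {1..nat \<lfloor>X\<rfloor>}"
    by (auto simp: le_nat_floor) linarith
  thus ?thesis unfolding Gamma_sum_def moebius_mu_square quad_def[symmetric]
    by (simp add: if_distrib[of real_of_int] sum.inter_filter[symmetric] cong: if_cong)
qed

text \<open>Replacing \<open>X\<close> by its integer part changes the main term by at most
  \<open>sigma_const\<close>, which is absorbed because the error function \<open>g\<close> is at
  least 1 for \<open>X \<ge> 1\<close>.\<close>

lemma Gamma_sum_bigo:
  "(\<lambda>X. Gamma_sum X - sigma_const * X) \<in> O(\<lambda>X. X powr (4 / 5) * (1 + log 2 (7 * X)))"
proof -
  define C where "C = 283 + 256 * zeta_4_3"
  show ?thesis
  proof (rule bigoI[of _ "C + sigma_const"], rule eventually_mono[OF eventually_ge_at_top[of 1]])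
    fix X :: real assume X: "X \<ge> 1"
    define N where "N = nat \<lfloor>X\<rfloor>"
    have N: "N > 0" "real N \<le> X" "X \<le> real N + 1" using X unfolding N_def by linarith+
    define g where "g = (\<lambda>X. X powr (4 / 5) * (1 + log 2 (7 * X)))"
    have "1 * 1 \<le> g X" unfolding g_def using X by (intro mult_mono) (auto intro: ge_one_powr_ge_zero)
    have "\<bar>Gamma_sum X - sigma_const * X\<bar> \<le> \<bar>Gamma_sum X - sigma_const * real N\<bar> + sigma_const * (X - real N)"
    proof -
      have "0 \<le> sigma_const * (X - real N)" using sigma_const_pos N by simp
      thus ?thesis by (simp add: algebra_simps)
    qed
    also have "\<dots> \<le> C * g (real N) + sigma_const * 1"
      unfolding Gamma_sum_eq_card N_def[symmetric] C_def g_def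
      using N sigma_const_pos zeta_4_3_nonneg by (intro add_mono card_squarefree_quad_error mult_left_mono) auto
    also have "\<dots> \<le> C * g X + sigma_const * g X"
    proof (intro add_mono mult_left_mono)
      show "g (real N) \<le> g X" unfolding g_def using N by (intro mult_mono powr_mono2) auto
    qed (use sigma_const_pos \<open>1 * 1 \<le> g X\<close> zeta_4_3_nonneg in \<open>auto simp: C_def\<close>)
    finally show "norm (Gamma_sum X - sigma_const * X) \<le> (C + sigma_const) * norm (X powr (4 / 5) * (1 + log 2 (7 * X)))"
      using \<open>1 * 1 \<le> g X\<close> by (simp add: g_def algebra_simps)
  qed
qed

lemma Gamma_sum_bigo_powr:
  assumes "\<epsilon> > 0"
  shows "(\<lambda>X. Gamma_sum X - sigma_const * X) \<in> O(\<lambda>X. X powr (4 / 5 + \<epsilon>))"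
proof -
  have "(\<lambda>X. X powr (4 / 5) * (1 + log 2 (7 * X))) \<in> O(\<lambda>X::real. X powr (4 / 5 + \<epsilon>))"
    using assms by real_asymp
  with Gamma_sum_bigo show ?thesis by (rule landau_o.big_trans)
qed

text \<open>Finitely many such \<open>n\<close> would make \<open>Gamma_sum\<close> bounded, so
  \<open>sigma_const * X\<close> would be swallowed by the error term, contradicting
  \<open>sigma_const > 0\<close>.\<close>

lemma infinite_squarefree_quad: "infinite {n. n > 0 \<and> squarefree (quad n)}"
proof
  define S where "S = {n. n > 0 \<and> squarefree (quad n)}"
  assume "finite {n. n > 0 \<and> squarefree (quad n)}"
  hence fin: "finite S" by (simp add: S_def)
  have "Gamma_sum \<in> O(\<lambda>_::real. 1)"
  proof (rule bigoI[of _ "real (card S)"], rule always_eventually, rule allI)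
    fix X :: real
    have "card {n \<in> {1..nat \<lfloor>X\<rfloor>}. squarefree (quad n)} \<le> card S"
      by (rule card_mono[OF fin]) (auto simp: S_def)
    thus "norm (Gamma_sum X) \<le> real (card S) * norm (1::real)" by (simp add: Gamma_sum_eq_card)
  qed
  \<comment> \<open>The value 1/10 stands for any positive number below 1/5, which keeps the
    exponent below 1.\<close>
  also have "(\<lambda>_. 1::real) \<in> O(\<lambda>X::real. X powr (4 / 5 + 1 / 10))" by real_asymp
  finally have "(\<lambda>X::real. Gamma_sum X - (Gamma_sum X - sigma_const * X)) \<in> O(\<lambda>X. X powr (4 / 5 + 1 / 10))"
    by (rule sum_in_bigo) (rule Gamma_sum_bigo_powr, simp)
  hence "(\<lambda>X. X) \<in> O(\<lambda>X::real. X powr (4 / 5 + 1 / 10))" using sigma_const_pos by simp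
  moreover have "(\<lambda>X::real. X powr (4 / 5 + 1 / 10)) \<in> o(\<lambda>X. X)" by real_asymp
  ultimately have "(\<lambda>X::real. X) \<in> o(\<lambda>X. X)" by (rule landau_o.big_small_trans)
  hence "eventually (\<lambda>X::real. X = 0) at_top" by (simp add: landau_o.small_refl_iff)
  moreover have "eventually (\<lambda>X::real. X > 0) at_top" by (rule eventually_gt_at_top)
  ultimately have "eventually (\<lambda>X::real. False) at_top" by eventually_elim simp
  thus False by simp
qed

text \<open>The first conjunct certifies that the infinite product converges to
  \<open>sigma_const\<close>; \<open>prodinf\<close> by itself makes no claim of
  convergence.\<close>

theorem theorem1:
  shows "euler_factor has_prod sigma_const
    \<and> (\<forall>\<epsilon>>0. (\<lambda>X. Gamma_sum X - sigma_const * X) \<in> O[at_top](\<lambda>X. X powr (4 / 5 + \<epsilon>)))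
    \<and> infinite {n::nat. n > 0 \<and> squarefree (n\<^sup>2 + n + 1)}"
  using euler_factor_has_prod Gamma_sum_bigo_powr infinite_squarefree_quad
  unfolding quad_def by blast

end
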